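(* Let $I=(R,\pi)$ be an interpreted system such that (U) $I\models \overline{fire}\to\overline{start}$, and (R) $I\models \overline{fire}\to\bigwedge_{j\in\mathcal A}\lozenge(correct_j\to\overline{fire}_j)$. Then for every agent $i\in\mathcal A$, $$I\models \overline{fire}_i\to B_i\bigl(\overline{start}\wedge C^{\lozenge H}\,\overline{start}\bigr).$$
   Context: Model. $\mathcal A=\{1,\dots,n\}$ is a finite set of agents; time ranges over $\mathbb N$. A run $r$ assigns to each $t\in\mathbb N$ a global state $r(t)=(r_\epsilon(t),r_1(t),\dots,r_n(t))$ consisting of the environment state and the local state (local history) $r_i(t)$ of each agent $i$. Agents may become byzantine faulty. An interpreted system is a pair $I=(R,\pi)$ with $R$ a set of runs and $\pi$ a valuation of atomic propositions at points $(r,t)$, $r\in R$, $t\in\mathbb N$. Agents are asynchronous (a local state may stay unchanged over several rounds) and have perfect recall: recorded actions/events are never removed from a local history, and if $r_i(t)=r'_i(t')$ and $s\le t$ then there is $s'\le t'$ with $r'_i(s')=r_i(s)$. Formulas are built from atomic propositions by Boolean connectives, $K_i$ ($i\in\mathcal A$), $\lozenge$, $Y$, with $\Box\varphi:=\neg\lozenge\neg\varphi$. Semantics: $(I,r,t)\models K_i\varphi$ iff $(I,r',t')\models\varphi$ for all $r'\in R$, $t'\in\mathbb N$ with $r_i(t)=r'_i(t')$; $(I,r,t)\models\lozenge\varphi$ iff $(I,r,t')\models\varphi$ for some $t'\ge t$; $(I,r,t)\models Y\varphi$ iff $t>0$ and $(I,r,t-1)\models\varphi$. $I\models\varphi$ means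 $\varphi$ holds at all points $(r,t)$ with $r\in R$, $t\in\mathbb N$. Designated atoms: $correct_i$ holds at $(r,t)$ iff no faulty event happened to $i$ in $r$ by time $t$ (so once false in a run it stays false). For an action/event $o\in\{\mathrm{START},\mathrm{FIRE}\}$, $\overline{occurred}_i(o)$ holds at $(r,t)$ iff $r_i(t)$ contains an accurate record of $o$ occurring; whether $r_i(t)$ contains a record of $o$ depends only on the local state $r_i(t)$, and if $correct_i$ holds at $(r,t)$ then every record in $r_i(t)$ is accurate. Abbreviations: $\overline{start}_i:=Y\,\overline{occurred}_i(\mathrm{START})\wedge correct_i$; $\overline{fire}_i:=\overline{occurred}_i(\mathrm{FIRE})\wedge correct_i$; $\overline{start}:=\bigvee_{j\in\mathcal A}\overline{start}_j$; $\overline{fire}:=\bigvee_{j\in\mathcal A}\overline{fire}_j$. Belief: $B_i\varphi:=K_i(correct_i\to\varphi)$. Hope: $H_i\varphi:=correct_i\to B_i\varphi$. Eventual mutual hope: $E^{\lozenge H}\varphi:=\bigwedge_{j\in\mathcal A}\lozenge H_j\varphi$. Eventual common hope $C^{\lozenge H}\varphi$ is the greatest fixed point of $\chi\leftrightarrow E^{\lozenge H}(\varphi\wedge\chi)$, i.e. it holds exactly on the greatest set $X$ of points such that $X$ equals the set of points satisfying $E^{\lozenge H}(\varphi\wedge\chi)$ when $\chi$ is interpreted as $X$. *)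

theory Defs
  imports Main
begin

text \<open>
  The agents are the elements of an arbitrary finite type \<open>'a\<close>. A global state pairs the
  environment state with the local states of all agents.
\<close>

type_synonym ('a, 'l, 'e) run = "nat \<Rightarrow> 'e \<times> ('a \<Rightarrow> 'l)"
type_synonym ('a, 'l, 'e) point = "('a, 'l, 'e) run \<times> nat"
type_synonym ('a, 'l, 'e, 'q) isystem =
  "('a, 'l, 'e) run set \<times> (('a, 'l, 'e) run \<Rightarrow> nat \<Rightarrow> 'q \<Rightarrow> bool)"

definition lstate :: "('a, 'l, 'e) run \<Rightarrow> 'a \<Rightarrow> nat \<Rightarrow> 'l" where
  "lstate r i t = snd (r t) i"

text \<open>
  \<open>Conj f\<close> is the finite conjunction of \<open>f j\<close> over all agents \<open>j\<close>. \<open>Var\<close> and \<open>Nu\<close> only serve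
  to express eventual common hope: \<open>Nu x \<phi>\<close> is the greatest fixed point of \<open>x \<leftrightarrow> \<phi>\<close>, and this
  reading is intended only for bodies \<open>\<phi>\<close> that are monotone in \<open>x\<close>.
\<close>

datatype ('a, 'q) fm =
    Atom 'q
  | Var nat
  | Neg "('a, 'q) fm"
  | And "('a, 'q) fm" "('a, 'q) fm"  (infixr \<open>\<^bold>\<and>\<close> 65)
  | Conj "'a \<Rightarrow> ('a, 'q) fm"
  | K 'a "('a, 'q) fm"
  | Ev "('a, 'q) fm"
  | Yest "('a, 'q) fm"
  | Nu nat "('a, 'q) fm"

definition Imp :: "('a, 'q) fm \<Rightarrow> ('a, 'q) fm \<Rightarrow> ('a, 'q) fm"  (infixr \<open>\<^bold>\<longrightarrow>\<close> 55) where
  "(\<phi> \<^bold>\<longrightarrow> \<psi>) = Neg (\<phi> \<^bold>\<and> Neg \<psi>)"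

definition Disj :: "('a \<Rightarrow> ('a, 'q) fm) \<Rightarrow> ('a, 'q) fm" where
  "Disj f = Neg (Conj (\<lambda>j. Neg (f j)))"

primrec sat :: "('a, 'l, 'e, 'q) isystem \<Rightarrow> (nat \<Rightarrow> ('a, 'l, 'e) point set) \<Rightarrow>
    ('a, 'l, 'e) run \<Rightarrow> nat \<Rightarrow> ('a, 'q) fm \<Rightarrow> bool" where
  "sat I V r t (Atom p) \<longleftrightarrow> snd I r t p"
| "sat I V r t (Var x) \<longleftrightarrow> (r, t) \<in> V x"
| "sat I V r t (Neg \<phi>) \<longleftrightarrow> \<not> sat I V r t \<phi>"
| "sat I V r t (\<phi> \<^bold>\<and> \<psi>) \<longleftrightarrow> sat I V r t \<phi> \<and> sat I V r t \<psi>"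
| "sat I V r t (Conj f) \<longleftrightarrow> (\<forall>j. sat I V r t (f j))"
| "sat I V r t (K i \<phi>) \<longleftrightarrow>
     (\<forall>r'\<in>fst I. \<forall>t'. lstate r i t = lstate r' i t' \<longrightarrow> sat I V r' t' \<phi>)"
| "sat I V r t (Ev \<phi>) \<longleftrightarrow> (\<exists>t'\<ge>t. sat I V r t' \<phi>)"
| "sat I V r t (Yest \<phi>) \<longleftrightarrow> t > 0 \<and> sat I V r (t - 1) \<phi>"
| "sat I V r t (Nu x \<phi>) \<longleftrightarrow>
     (r, t) \<in> gfp (\<lambda>X. {(r', t'). r' \<in> fst I \<and> sat I (V(x := X)) r' t' \<phi>})"

text \<open>Validity is meant for formulas without free variables, hence the irrelevant assignment.\<close>

definition valid :: "('a, 'l, 'e, 'q) isystem \<Rightarrow> ('a, 'q) fm \<Rightarrow> bool"  (infix \<open>\<Turnstile>\<close> 50) where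
  "I \<Turnstile> \<phi> \<longleftrightarrow> (\<forall>r\<in>fst I. \<forall>t. sat I (\<lambda>_. {}) r t \<phi>)"

datatype 'o event = START | FIRE | Other 'o

datatype ('a, 'o, 'p) atom = Correct 'a | Occurred 'a "'o event" | Prop 'p

type_synonym ('a, 'o, 'p) bfm = "('a, ('a, 'o, 'p) atom) fm"

definition correct :: "'a \<Rightarrow> ('a, 'o, 'p) bfm" where
  "correct i = Atom (Correct i)"

definition start_at :: "'a \<Rightarrow> ('a, 'o, 'p) bfm" where
  "start_at i = Yest (Atom (Occurred i START)) \<^bold>\<and> correct i"

definition fire_at :: "'a \<Rightarrow> ('a, 'o, 'p) bfm" where
  "fire_at i = Atom (Occurred i FIRE) \<^bold>\<and> correct i"

definition start :: "('a, 'o, 'p) bfm" where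
  "start = Disj start_at"

definition fire :: "('a, 'o, 'p) bfm" where
  "fire = Disj fire_at"

definition B :: "'a \<Rightarrow> ('a, 'o, 'p) bfm \<Rightarrow> ('a, 'o, 'p) bfm" where
  "B i \<phi> = K i (correct i \<^bold>\<longrightarrow> \<phi>)"

definition H :: "'a \<Rightarrow> ('a, 'o, 'p) bfm \<Rightarrow> ('a, 'o, 'p) bfm" where
  "H i \<phi> = (correct i \<^bold>\<longrightarrow> B i \<phi>)"

definition EH :: "('a, 'o, 'p) bfm \<Rightarrow> ('a, 'o, 'p) bfm" where
  "EH \<phi> = Conj (\<lambda>j. Ev (H j \<phi>))"

text \<open>A strict upper bound of all variables of a formula, so that \<open>CH\<close> below avoids capture.\<close>

primrec fresh :: "('a::finite, 'q) fm \<Rightarrow> nat" where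
  "fresh (Atom p) = 0"
| "fresh (Var x) = Suc x"
| "fresh (Neg \<phi>) = fresh \<phi>"
| "fresh (\<phi> \<^bold>\<and> \<psi>) = max (fresh \<phi>) (fresh \<psi>)"
| "fresh (Conj f) = Max (range (\<lambda>j. fresh (f j)))"
| "fresh (K i \<phi>) = fresh \<phi>"
| "fresh (Ev \<phi>) = fresh \<phi>"
| "fresh (Yest \<phi>) = fresh \<phi>"
| "fresh (Nu x \<phi>) = max (Suc x) (fresh \<phi>)"

definition CH :: "('a::finite, 'o, 'p) bfm \<Rightarrow> ('a, 'o, 'p) bfm" where
  "CH \<phi> = Nu (fresh \<phi>) (EH (\<phi> \<^bold>\<and> Var (fresh \<phi>)))"

lemma sat_fresh:
  "x \<ge> fresh \<phi> \<Longrightarrow> sat I (V(x := X)) r t \<phi> \<longleftrightarrow> sat I V r t \<phi>"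
proof (induction \<phi> arbitrary: V r t)
  case (Nu y \<phi>)
  have "sat I (V(x := X, y := Y)) r' t' \<phi> \<longleftrightarrow> sat I (V(y := Y)) r' t' \<phi>" for Y r' t'
  proof -
    have "V(x := X, y := Y) = V(y := Y, x := X)"
      using Nu.prems by (intro fun_upd_twist) simp
    then show ?thesis
      using Nu.IH Nu.prems by (simp del: fun_upd_apply)
  qed
  then show ?case by (simp del: fun_upd_apply)
qed simp_all

text \<open>
  \<open>CH \<phi>\<close> holds exactly on the greatest set of points that equals the set of points satisfying
  \<open>EH (\<phi> \<and> \<chi>)\<close> when \<open>\<chi>\<close> is interpreted as that set.
\<close>

lemma CH_greatest_fixed_point:
  fixes \<phi> :: "('a::finite, 'o, 'p) bfm" and I :: "('a, 'l, 'e, ('a, 'o, 'p) atom) isystem"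
    and V :: "nat \<Rightarrow> ('a, 'l, 'e) point set"
  defines "x \<equiv> fresh \<phi>"
  defines "F \<equiv> \<lambda>X. {(r, t). r \<in> fst I \<and> sat I (V(x := X)) r t (EH (\<phi> \<^bold>\<and> Var x))}"
  defines "C \<equiv> {(r, t). sat I V r t (CH \<phi>)}"
  shows "C = F C" and "\<And>X. X = F X \<Longrightarrow> X \<subseteq> C"
proof -
  have mono: "mono F"
  proof (rule monoI)
    fix X Y :: "('a, 'l, 'e) point set"
    assume "X \<subseteq> Y"
    then show "F X \<subseteq> F Y"
      unfolding F_def x_def EH_def H_def B_def Imp_def correct_def
      by (simp add: sat_fresh del: fun_upd_apply) (simp, blast)
  qed
  have C: "C = gfp F"
    by (auto simp: C_def CH_def F_def x_def)
  show "C = F C"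
    unfolding C by (rule gfp_unfold[OF mono])
  show "X \<subseteq> C" if "X = F X" for X
    unfolding C by (rule gfp_upperbound) (use that in simp)
qed

text \<open>
  \<open>faulty r s i\<close>: a faulty event happens to agent \<open>i\<close> in run \<open>r\<close> at time \<open>s\<close>.
  \<open>records i l\<close>: the records contained in the local state \<open>l\<close> of agent \<open>i\<close>, where record \<open>c\<close>
  is a record of the event \<open>event_of c\<close>.
  \<open>accurate r t i c\<close>: record \<open>c\<close> of agent \<open>i\<close> is accurate at the point \<open>(r, t)\<close>.
  Asynchrony is the absence of any requirement that local states change from round to round.
\<close>

locale byzantine_system =
  fixes R :: "('a::finite, 'l, 'e) run set"
    and \<pi> :: "('a, 'l, 'e) run \<Rightarrow> nat \<Rightarrow> ('a, 'o, 'p) atom \<Rightarrow> bool"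
    and faulty :: "('a, 'l, 'e) run \<Rightarrow> nat \<Rightarrow> 'a \<Rightarrow> bool"
    and records :: "'a \<Rightarrow> 'l \<Rightarrow> 'c set"
    and event_of :: "'c \<Rightarrow> 'o event"
    and accurate :: "('a, 'l, 'e) run \<Rightarrow> nat \<Rightarrow> 'a \<Rightarrow> 'c \<Rightarrow> bool"
  assumes records_kept:
      "\<lbrakk>r \<in> R; s \<le> t\<rbrakk> \<Longrightarrow> records i (lstate r i s) \<subseteq> records i (lstate r i t)"
    and perfect_recall:
      "\<lbrakk>r \<in> R; r' \<in> R; lstate r i t = lstate r' i t'; s \<le> t\<rbrakk>
        \<Longrightarrow> \<exists>s'\<le>t'. lstate r' i s' = lstate r i s"
    and correct_iff:
      "r \<in> R \<Longrightarrow> \<pi> r t (Correct i) \<longleftrightarrow> (\<forall>s\<le>t. \<not> faulty r s i)"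
    and occurred_iff:
      "r \<in> R \<Longrightarrow> \<pi> r t (Occurred i ev) \<longleftrightarrow>
        (\<exists>c \<in> records i (lstate r i t). event_of c = ev \<and> accurate r t i c)"
    and correct_accurate:
      "\<lbrakk>r \<in> R; \<pi> r t (Correct i); c \<in> records i (lstate r i t)\<rbrakk> \<Longrightarrow> accurate r t i c"

end

theory Submission
  imports Defs
begin

text \<open>
  Records are local and accurate as long as their owner is correct, so an agent that fires while
  correct believes that it fires. Hence by (R) the set of points satisfying \<open>fire\<close> is a
  post-fixed point of \<open>\<chi> \<mapsto> EH (fire \<and> \<chi>)\<close>, and by (U) also of \<open>\<chi> \<mapsto> EH (start \<and> \<chi>)\<close>.
\<close>

lemma sat_Imp [simp]: "sat I V r t (\<phi> \<^bold>\<longrightarrow> \<psi>) \<longleftrightarrow> (sat I V r t \<phi> \<longrightarrow> sat I V r t \<psi>)"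
  by (simp add: Imp_def)

lemma sat_Disj [simp]: "sat I V r t (Disj f) \<longleftrightarrow> (\<exists>j. sat I V r t (f j))"
  by (simp add: Disj_def)

lemma CH_coinduct:
  assumes "(r, t) \<in> X" and "X \<subseteq> fst I \<times> UNIV"
    and "\<And>r t j. (r, t) \<in> X \<Longrightarrow> \<exists>t'\<ge>t. sat I V r t' (correct j) \<longrightarrow>
      (\<forall>r'\<in>fst I. \<forall>s. lstate r j t' = lstate r' j s \<and> sat I V r' s (correct j) \<longrightarrow>
        sat I V r' s \<phi> \<and> (r', s) \<in> X)"
  shows "sat I V r t (CH \<phi>)"
proof -
  define x where "x = fresh \<phi>"
  \<comment> \<open>As \<open>x\<close> is fresh for \<open>\<phi>\<close>, \<open>sat_fresh\<close>
    lets \<open>\<phi>\<close> be evaluated under \<open>V\<close> itself.\<close>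
  have "X \<subseteq> {(r, t). r \<in> fst I \<and> sat I (V(x := X)) r t (EH (\<phi> \<^bold>\<and> Var x))}"
  proof clarify
    fix r t assume "(r, t) \<in> X"
    then show "r \<in> fst I \<and> sat I (V(x := X)) r t (EH (\<phi> \<^bold>\<and> Var x))"
      using assms(2) assms(3)[of r t]
      by (fastforce simp: EH_def H_def B_def correct_def x_def sat_fresh fun_upd_same
          simp del: fun_upd_apply)
  qed
  then have "X \<subseteq> gfp (\<lambda>X. {(r, t). r \<in> fst I \<and> sat I (V(x := X)) r t (EH (\<phi> \<^bold>\<and> Var x))})"
    by (rule gfp_upperbound)
  with assms(1) show ?thesis
    by (auto simp: CH_def x_def)
qed

text \<open>Equal local states contain the same FIRE record. Accuracy depends on the point, so it is
  derived afresh at \<open>(r', t')\<close> from correctness there.\<close>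

lemma (in byzantine_system) fire_at_transfer:
  assumes "r \<in> R" and "r' \<in> R" and "lstate r i t = lstate r' i t'"
    and "sat (R, \<pi>) V r t (fire_at i)" and "sat (R, \<pi>) V r' t' (correct i)"
  shows "sat (R, \<pi>) V r' t' (fire_at i)"
proof -
  obtain c where "c \<in> records i (lstate r i t)" "event_of c = FIRE"
    using assms(1,4) by (auto simp: fire_at_def occurred_iff)
  with assms correct_accurate show ?thesis
    by (auto simp: fire_at_def correct_def occurred_iff)
qed

theorem theorem14:
  fixes R :: "('a::finite, 'l, 'e) run set"
    and \<pi> :: "('a, 'l, 'e) run \<Rightarrow> nat \<Rightarrow> ('a, 'o, 'p) atom \<Rightarrow> bool"
    and faulty :: "('a, 'l, 'e) run \<Rightarrow> nat \<Rightarrow> 'a \<Rightarrow> bool"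
    and records :: "'a \<Rightarrow> 'l \<Rightarrow> 'c set"
    and event_of :: "'c \<Rightarrow> 'o event"
    and accurate :: "('a, 'l, 'e) run \<Rightarrow> nat \<Rightarrow> 'a \<Rightarrow> 'c \<Rightarrow> bool"
  assumes system: "byzantine_system R \<pi> faulty records event_of accurate"
    and U: "(R, \<pi>) \<Turnstile> fire \<^bold>\<longrightarrow> start"
    and Relay: "(R, \<pi>) \<Turnstile> fire \<^bold>\<longrightarrow> Conj (\<lambda>j. Ev (correct j \<^bold>\<longrightarrow> fire_at j))"
  shows "\<forall>i. (R, \<pi>) \<Turnstile> fire_at i \<^bold>\<longrightarrow> B i (start \<^bold>\<and> CH start)"
proof -
  interpret byzantine_system R \<pi> faulty records event_of accurate
    by (rule system)
  let ?sat = "sat (R, \<pi>) (\<lambda>_. {})"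
  \<comment> \<open>The set collects points of \<open>fire\<close> rather than \<open>start\<close>,
    since (R) propagates firing only.\<close>
  define X where "X = {(r, t). r \<in> R \<and> ?sat r t fire}"
  have X_start: "?sat r t start" if "(r, t) \<in> X" for r t
    using U that by (auto simp: valid_def X_def)
  have X_I: "(r', t') \<in> X"
    if "r \<in> R" "r' \<in> R" "lstate r i t = lstate r' i t'" "?sat r t (fire_at i)"
      "?sat r' t' (correct i)" for r r' i t t'
    using that fire_at_transfer[of r r' i t t'] by (auto simp: X_def fire_def)
  have X_CH: "?sat r t (CH start)" if "(r, t) \<in> X" for r t
    using that
  proof (rule CH_coinduct)
    show "X \<subseteq> fst (R, \<pi>) \<times> UNIV"
      by (auto simp: X_def)
  next
    fix r t j assume rt: "(r, t) \<in> X"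
    then have "r \<in> R"
      by (simp add: X_def)
    \<comment> \<open>At this \<open>t'\<close> the hope of \<open>j\<close> is vacuous if
      \<open>j\<close> is faulty; otherwise \<open>j\<close> fires, and \<open>X_I\<close> carries
      this to every indistinguishable point where \<open>j\<close> is correct.\<close>
    from rt Relay obtain t' where "t' \<ge> t" "?sat r t' (correct j) \<longrightarrow> ?sat r t' (fire_at j)"
      by (simp add: valid_def X_def) blast
    then show "\<exists>t'\<ge>t. ?sat r t' (correct j) \<longrightarrow>
        (\<forall>r'\<in>fst (R, \<pi>). \<forall>s. lstate r j t' = lstate r' j s \<and> ?sat r' s (correct j) \<longrightarrow>
          ?sat r' s start \<and> (r', s) \<in> X)"
      using X_I[OF \<open>r \<in> R\<close>] X_start by (metis fst_conv)
  qed
  \<comment> \<open>Every point that \<open>i\<close> considers possible and where \<open>i\<close>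
    is correct lies in \<open>X\<close> by \<open>X_I\<close>, hence satisfies both
    conjuncts.\<close>
  show ?thesis
    using X_I X_start X_CH by (auto simp: valid_def B_def)
qed

end
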